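(* Let $\alpha\in(0,1)$ be irrational, with continued fraction convergents $p_n/q_n$. For $n\in\mathbb{N}$ let $$J_n=\{k\in[1,q_{n+1}-1]\cap\mathbb{Z}:\ \gcd(\lfloor k\alpha\rfloor,k)=1\},$$ and for an interval $I\subset[0,1)$ let $\hat J_n=\hat J_n(I)=\{k\in J_n:\ \{k\alpha\}\in I\}$. Then there exists a strictly increasing sequence $(n_k)$ of positive integers, not depending on $I$, such that for every interval $I\subset[0,1)$, $$\#\hat J_{n_k}(I)=(\kappa|I|+o(1))\,q_{n_k+1}\quad\text{as }k\to\infty,$$ where $\kappa=\prod_{p\text{ prime}}(1-p^{-2})=6/\pi^2$.
   Context: The continued fraction expansion of $\alpha\in(0,1)\setminus\mathbb{Q}$ is written $\alpha=[a_1,a_2,\dots]=\cfrac{1}{a_1+\cfrac{1}{a_2+\cdots}}$, and $p_n/q_n=[a_1,\dots,a_n]$ with $\gcd(p_n,q_n)=1$. $\{x\}=x-\lfloor x\rfloor$ denotes the fractional part, $|I|$ the Lebesgue measure (length) of $I$, and $\#S$ the cardinality of a finite set $S$. *)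

theory Defs
  imports "HOL-Analysis.Analysis" "HOL-Computational_Algebra.Primes"
begin

definition gauss_map :: "real \<Rightarrow> real" where
  "gauss_map x = frac (1 / x)"

text \<open>The digit \<open>a\<^sub>n\<close> of \<open>\<alpha> = [a\<^sub>1, a\<^sub>2, \<dots>]\<close>; the index starts at 1, and the value at 0 is meaningless.\<close>
definition cf_digit :: "real \<Rightarrow> nat \<Rightarrow> int" where
  "cf_digit \<alpha> n = \<lfloor>1 / (gauss_map ^^ (n - 1)) \<alpha>\<rfloor>"

fun cf_eval :: "int list \<Rightarrow> 'a :: field" where
  "cf_eval [] = 0"
| "cf_eval (a # as) = 1 / (of_int a + cf_eval as)"

definition cf_convergent :: "real \<Rightarrow> nat \<Rightarrow> rat" where
  "cf_convergent \<alpha> n = cf_eval (map (cf_digit \<alpha>) [1..<n + 1])"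

text \<open>The denominator \<open>q\<^sub>n > 0\<close> of \<open>[a\<^sub>1, \<dots>, a\<^sub>n] = p\<^sub>n / q\<^sub>n\<close> in lowest terms.\<close>
definition cf_denom :: "real \<Rightarrow> nat \<Rightarrow> int" where
  "cf_denom \<alpha> n = snd (quotient_of (cf_convergent \<alpha> n))"

definition J :: "real \<Rightarrow> nat \<Rightarrow> int set" where
  "J \<alpha> n = {k \<in> {1..cf_denom \<alpha> (n + 1) - 1}. gcd \<lfloor>of_int k * \<alpha>\<rfloor> k = 1}"

definition J_hat :: "real \<Rightarrow> nat \<Rightarrow> real set \<Rightarrow> int set" where
  "J_hat \<alpha> n I = {k \<in> J \<alpha> n. frac (of_int k * \<alpha>) \<in> I}"

definition kappa :: real where
  "kappa = (\<Prod>p. if prime p then 1 - 1 / real p ^ 2 else 1)"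

lemma convergent_prod_kappa:
  "convergent_prod (\<lambda>p. if prime p then 1 - 1 / real p ^ 2 else 1)"
proof (rule abs_convergent_prod_imp_convergent_prod)
  have "summable (\<lambda>p. norm ((if prime p then 1 - 1 / real p ^ 2 else 1) - 1))"
  proof (rule summable_comparison_test')
    show "summable (\<lambda>p. 1 / real p ^ 2)"
      using inverse_power_summable[of 2, where ?'a = real] by (simp add: field_simps)
  qed auto
  thus "abs_convergent_prod (\<lambda>p. if prime p then 1 - 1 / real p ^ 2 else 1)"
    by (simp add: abs_convergent_prod_conv_summable)
qed

text \<open>The digits produced by the Gauss map do give an expansion of \<open>\<alpha>\<close>: they are positive and
  the convergents tend to \<open>\<alpha>\<close>.\<close>

lemma gauss_map_irrational:
  assumes "x \<notin> \<rat>"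
  shows "0 < gauss_map x" "gauss_map x < 1" "gauss_map x \<notin> \<rat>"
proof -
  have *: "1 / x \<notin> \<rat>"
    using assms Rats_divide[of 1 "1 / x"] by auto
  show irr: "gauss_map x \<notin> \<rat>"
  proof
    assume "gauss_map x \<in> \<rat>"
    hence "gauss_map x + of_int \<lfloor>1 / x\<rfloor> \<in> \<rat>" by (intro Rats_add) auto
    thus False using * by (simp add: gauss_map_def frac_def)
  qed
  show "gauss_map x < 1" by (simp add: gauss_map_def frac_lt_1)
  show "0 < gauss_map x"
    using irr frac_ge_0[of "1 / x"] by (metis Rats_0 gauss_map_def order_le_less)
qed

lemma gauss_map_unfold: "1 / (of_int \<lfloor>1 / x\<rfloor> + gauss_map x) = x"
proof -
  have "of_int \<lfloor>1 / x\<rfloor> + gauss_map x = 1 / x"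
    unfolding gauss_map_def frac_def by linarith
  thus ?thesis by (metis divide_divide_eq_right mult_1 div_by_1)
qed

lemma gauss_map_iterate_irrational:
  assumes "0 < \<alpha>" "\<alpha> < 1" "\<alpha> \<notin> \<rat>"
  shows "0 < (gauss_map ^^ n) \<alpha> \<and> (gauss_map ^^ n) \<alpha> < 1 \<and> (gauss_map ^^ n) \<alpha> \<notin> \<rat>"
  using assms by (induction n) (auto simp: gauss_map_irrational)

lemma cf_digit_ge_1:
  assumes "0 < \<alpha>" "\<alpha> < 1" "\<alpha> \<notin> \<rat>"
  shows "cf_digit \<alpha> n \<ge> 1"
  using gauss_map_iterate_irrational[OF assms, of "n - 1"]
  by (simp add: cf_digit_def le_floor_iff)

lemma map_cf_digit_Suc:
  "map (cf_digit \<alpha>) [1..<Suc n + 1] = \<lfloor>1 / \<alpha>\<rfloor> # map (cf_digit (gauss_map \<alpha>)) [1..<n + 1]"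
proof (rule nth_equalityI)
  fix i assume "i < length (map (cf_digit \<alpha>) [1..<Suc n + 1])"
  thus "map (cf_digit \<alpha>) [1..<Suc n + 1] ! i =
      (\<lfloor>1 / \<alpha>\<rfloor> # map (cf_digit (gauss_map \<alpha>)) [1..<n + 1]) ! i"
    by (cases i) (auto simp: cf_digit_def funpow_swap1 nth_Cons simp del: upt_Suc)
qed simp

lemma cf_eval_nonneg:
  assumes "\<forall>a\<in>set as. a \<ge> 1"
  shows "(cf_eval as :: real) \<ge> 0"
  using assms by (induction as) auto

lemma of_rat_cf_eval: "(of_rat (cf_eval as) :: real) = cf_eval as"
  by (induction as) (auto simp: of_rat_divide of_rat_add)

lemma cf_two_step_contraction:
  fixes a b x y :: real
  assumes "a \<ge> 1" "b \<ge> 1" "x \<ge> 0" "y \<ge> 0"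
  shows "\<bar>1 / (a + 1 / (b + x)) - 1 / (a + 1 / (b + y))\<bar> \<le> \<bar>x - y\<bar> / 4"
proof -
  define u where "u = a * (b + x) + 1"
  define v where "v = a * (b + y) + 1"
  have "1 * 1 \<le> a * (b + x)" "1 * 1 \<le> a * (b + y)"
    using assms by (intro mult_mono; simp)+
  hence uv: "u \<ge> 2" "v \<ge> 2" by (simp_all add: u_def v_def)
  hence "2 * 2 \<le> u * v" by (intro mult_mono) auto
  hence uv4: "u * v \<ge> 4" by simp
  have ex: "1 / (a + 1 / (b + x)) = (b + x) / u" "1 / (a + 1 / (b + y)) = (b + y) / v"
    using assms by (simp_all add: u_def v_def field_simps)
  have "(b + x) / u - (b + y) / v = ((b + x) * v - (b + y) * u) / (u * v)"
    using uv by (simp add: field_simps)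
  also have "(b + x) * v - (b + y) * u = x - y"
    by (simp add: u_def v_def algebra_simps)
  finally have "\<bar>1 / (a + 1 / (b + x)) - 1 / (a + 1 / (b + y))\<bar> = \<bar>x - y\<bar> / (u * v)"
    using uv by (simp add: ex abs_mult)
  also have "\<dots> \<le> \<bar>x - y\<bar> / 4"
    using uv4 by (intro divide_left_mono) auto
  finally show ?thesis .
qed

lemma cf_convergent_error:
  assumes "0 < \<alpha>" "\<alpha> < 1" "\<alpha> \<notin> \<rat>"
  shows "\<bar>real_of_rat (cf_convergent \<alpha> n) - \<alpha>\<bar> \<le> 2 * (1 / 2) ^ n"
  using assms
proof (induction n arbitrary: \<alpha> rule: induct_nat_012)
  case 0
  thus ?case by (simp add: cf_convergent_def)
next
  case 1
  have d: "real_of_int \<lfloor>1 / \<alpha>\<rfloor> \<ge> 1"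
    using 1 by (simp add: le_floor_iff)
  have "1 / real_of_int \<lfloor>1 / \<alpha>\<rfloor> \<le> 1" "1 / real_of_int \<lfloor>1 / \<alpha>\<rfloor> \<ge> 0"
    using d unfolding divide_le_eq_1 zero_le_divide_iff by linarith+
  moreover have "real_of_rat (cf_convergent \<alpha> (Suc 0)) = 1 / real_of_int \<lfloor>1 / \<alpha>\<rfloor>"
    by (simp add: cf_convergent_def cf_digit_def of_rat_divide)
  ultimately have "\<bar>real_of_rat (cf_convergent \<alpha> (Suc 0)) - \<alpha>\<bar> \<le> 1"
    using 1 by linarith
  thus ?case by simp
next
  case (ge2 n)
  define \<beta> where "\<beta> = gauss_map \<alpha>"
  define \<gamma> where "\<gamma> = gauss_map \<beta>"
  note \<beta> = gauss_map_irrational[OF ge2.prems(3), folded \<beta>_def]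
  note \<gamma> = gauss_map_irrational[OF \<beta>(3), folded \<gamma>_def]
  define x where "x = real_of_rat (cf_convergent \<gamma> n)"
  have "real_of_rat (cf_convergent \<alpha> (Suc (Suc n))) =
      1 / (of_int \<lfloor>1 / \<alpha>\<rfloor> + 1 / (of_int \<lfloor>1 / \<beta>\<rfloor> + x))"
    unfolding cf_convergent_def map_cf_digit_Suc x_def \<beta>_def \<gamma>_def
    by (simp add: of_rat_divide of_rat_add del: upt_Suc)
  moreover have "1 / (of_int \<lfloor>1 / \<alpha>\<rfloor> + 1 / (of_int \<lfloor>1 / \<beta>\<rfloor> + \<gamma>)) = \<alpha>"
    using gauss_map_unfold[of \<alpha>] gauss_map_unfold[of \<beta>]
    by (simp add: \<beta>_def \<gamma>_def)
  moreover have "real_of_int \<lfloor>1 / \<alpha>\<rfloor> \<ge> 1" "real_of_int \<lfloor>1 / \<beta>\<rfloor> \<ge> 1"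
    using ge2.prems \<beta> by (simp_all add: le_floor_iff)
  moreover have "x \<ge> 0"
    unfolding x_def cf_convergent_def of_rat_cf_eval
    using cf_digit_ge_1[OF \<gamma>] by (intro cf_eval_nonneg) auto
  ultimately have "\<bar>real_of_rat (cf_convergent \<alpha> (Suc (Suc n))) - \<alpha>\<bar> \<le> \<bar>x - \<gamma>\<bar> / 4"
    using cf_two_step_contraction[of "of_int \<lfloor>1 / \<alpha>\<rfloor>" "of_int \<lfloor>1 / \<beta>\<rfloor>" x \<gamma>] \<gamma> by simp
  also have "\<dots> \<le> 2 * (1 / 2) ^ n / 4"
    using ge2.IH(1)[OF \<gamma>] by (simp add: x_def)
  finally show ?case by simp
qed

lemma cf_convergent_tendsto:
  assumes "0 < \<alpha>" "\<alpha> < 1" "\<alpha> \<notin> \<rat>"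
  shows "(\<lambda>n. real_of_rat (cf_convergent \<alpha> n)) \<longlonglongrightarrow> \<alpha>"
proof -
  have "(\<lambda>n. 2 * (1 / 2 :: real) ^ n) \<longlonglongrightarrow> 2 * 0"
    by (intro tendsto_mult tendsto_const LIMSEQ_power_zero) auto
  hence lim: "(\<lambda>n. 2 * (1 / 2 :: real) ^ n) \<longlonglongrightarrow> 0" by simp
  have "(\<lambda>n. real_of_rat (cf_convergent \<alpha> n) - \<alpha>) \<longlonglongrightarrow> 0"
  proof (rule Lim_null_comparison[OF _ lim])
    show "\<forall>\<^sub>F n in sequentially.
        norm (real_of_rat (cf_convergent \<alpha> n) - \<alpha>) \<le> 2 * (1 / 2) ^ n"
      unfolding real_norm_def using cf_convergent_error[OF assms] by (intro always_eventually allI)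
  qed
  thus ?thesis by (rule LIM_zero_cancel)
qed

end

(* The multiples k = d m with d dividing floor(k alpha) are those with {m alpha} in I/d, so
   equidistribution of rotations gives them density |I|/d^2 among the k with {k alpha} in I, and
   sieving by the primes up to D leaves density |I| prod (1 - 1/p^2). It remains to bound, uniformly,
   the k < n whose gcd g with floor(k alpha) exceeds D. For a fixed g, the points
   (k/g, {k alpha}/g) are the images of pairwise distinct primitive lattice vectors under a
   unimodular map and lie in a box of area n/g^2, so there are at most 2 n/g^2 + 2 of them; for
   g > eps n there are none once n is large, by the irrationality of alpha. Summing over
   D < g <= eps n gives at most (2/D + 2 eps) n. All n are covered, so the sequence n_k = k + 1
   works. *)

theory Submission
  imports Defs
begin

lemma finite_int_section [simp]: "finite {k :: int. a \<le> k \<and> k < b \<and> P k}"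
  by (rule finite_subset[of _ "{a..<b}"]) auto

section \<open>Unimodular vectors in a box\<close>

text \<open>Cells of length \<open>s\<close> starting at \<open>a\<close> hold at most one value
  each, so the cell index \<open>u\<close> is injective on \<open>S\<close>.\<close>

lemma card_separated_reals_le:
  fixes f :: "'a \<Rightarrow> real"
  assumes "finite S" and "s > 0" and "a \<le> b"
    and range: "\<And>k. k \<in> S \<Longrightarrow> a \<le> f k \<and> f k \<le> b"
    and sep: "\<And>k l. k \<in> S \<Longrightarrow> l \<in> S \<Longrightarrow> k \<noteq> l \<Longrightarrow> \<bar>f k - f l\<bar> \<ge> s"
  shows "real (card S) \<le> (b - a) / s + 1"
proof -
  define u where "u k = \<lfloor>(f k - a) / s\<rfloor>" for k
  have "inj_on u S"
  proof (rule inj_onI, rule ccontr)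
    fix k l assume kl: "k \<in> S" "l \<in> S" "u k = u l" "k \<noteq> l"
    have "\<bar>(f k - a) / s - (f l - a) / s\<bar> < 1"
      using kl(3) unfolding u_def by linarith
    moreover have "(f k - a) / s - (f l - a) / s = (f k - f l) / s"
      by (simp add: diff_divide_distrib)
    ultimately have "\<bar>f k - f l\<bar> < s"
      using \<open>s > 0\<close> by (simp add: abs_divide)
    thus False using sep[of k l] kl by simp
  qed
  moreover have "u ` S \<subseteq> {0..\<lfloor>(b - a) / s\<rfloor>}"
    using range \<open>s > 0\<close> by (fastforce simp: u_def intro!: floor_mono divide_right_mono)
  ultimately have "card S \<le> card {0..\<lfloor>(b - a) / s\<rfloor>}"
    by (rule card_inj_on_le) simp
  moreover have "(b - a) / s \<ge> 0"
    using assms by simp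
  ultimately show ?thesis
    by (simp add: le_nat_iff) linarith
qed

text \<open>Vectors below the diagonal of the box are separated by their slopes, those above it by
  their inverse slopes.\<close>

lemma card_unimodular_vectors_in_box_le:
  fixes x t :: "'a \<Rightarrow> real"
  assumes "finite S" and "X > 0" and "T > 0"
    and box: "\<And>k. k \<in> S \<Longrightarrow> 0 < x k \<and> x k \<le> X \<and> 0 < t k \<and> t k \<le> T"
    and det: "\<And>k l. k \<in> S \<Longrightarrow> l \<in> S \<Longrightarrow> k \<noteq> l \<Longrightarrow> \<bar>x k * t l - x l * t k\<bar> \<ge> 1"
  shows "real (card S) \<le> 2 * X * T + 2"
proof -
  define S1 where "S1 = {k \<in> S. t k * X \<le> T * x k}"
  define S2 where "S2 = {k \<in> S. t k * X > T * x k}"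
  have "real (card S1) \<le> (T / X - 0) / (1 / X\<^sup>2) + 1"
  proof (rule card_separated_reals_le)
    fix k assume "k \<in> S1"
    thus "0 \<le> t k / x k \<and> t k / x k \<le> T / X"
      using box[of k] assms(2,3) by (auto simp: S1_def field_simps)
  next
    fix k l assume kl: "k \<in> S1" "l \<in> S1" "k \<noteq> l"
    note b = box[of k] box[of l] and d = det[of k l]
    \<comment> \<open>Two slopes differ by the determinant over \<open>x k * x l\<close>, hence by
      at least \<open>1 / X\<^sup>2\<close>. Below the diagonal the slopes lie in an interval of
      length \<open>T / X\<close>, which leaves room for \<open>X * T + 1\<close> of them. The other
      half is symmetric.\<close>
    have "1 / X\<^sup>2 \<le> 1 / (x k * x l)"
      using kl b assms(2) by (auto simp: S1_def power2_eq_square intro!: divide_left_mono mult_mono)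
    also have "\<dots> \<le> \<bar>x k * t l - x l * t k\<bar> / (x k * x l)"
      using kl b d by (intro divide_right_mono) (auto simp: S1_def)
    also have "\<dots> = \<bar>t k / x k - t l / x l\<bar>"
      using kl b by (simp add: S1_def divide_simps abs_mult abs_minus_commute mult.commute)
    finally show "1 / X\<^sup>2 \<le> \<bar>t k / x k - t l / x l\<bar>" .
  qed (use assms in \<open>auto simp: S1_def\<close>)
  moreover have "real (card S2) \<le> (X / T - 0) / (1 / T\<^sup>2) + 1"
  proof (rule card_separated_reals_le)
    fix k assume "k \<in> S2"
    thus "0 \<le> x k / t k \<and> x k / t k \<le> X / T"
      using box[of k] assms(2,3) by (auto simp: S2_def field_simps)
  next
    fix k l assume kl: "k \<in> S2" "l \<in> S2" "k \<noteq> l"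
    note b = box[of k] box[of l] and d = det[of k l]
    have "1 / T\<^sup>2 \<le> 1 / (t k * t l)"
      using kl b assms(3) by (auto simp: S2_def power2_eq_square intro!: divide_left_mono mult_mono)
    also have "\<dots> \<le> \<bar>x k * t l - x l * t k\<bar> / (t k * t l)"
      using kl b d by (intro divide_right_mono) (auto simp: S2_def)
    also have "\<dots> = \<bar>x k / t k - x l / t l\<bar>"
      using kl b by (simp add: S2_def divide_simps abs_mult mult.commute)
    finally show "1 / T\<^sup>2 \<le> \<bar>x k / t k - x l / t l\<bar>" .
  qed (use assms in \<open>auto simp: S2_def\<close>)
  moreover have "card S = card S1 + card S2"
    using \<open>finite S\<close> by (subst card_Un_disjoint[symmetric])
      (auto simp: S1_def S2_def intro!: arg_cong[where f = card])
  moreover have "(T / X - 0) / (1 / X\<^sup>2) = X * T" "(X / T - 0) / (1 / T\<^sup>2) = X * T"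
    using assms(2,3) by (simp_all add: power2_eq_square)
  ultimately show ?thesis by simp
qed

section \<open>Pairs with a prescribed greatest common divisor\<close>

lemma irrational_mult_int:
  fixes \<alpha> :: real and k :: int
  assumes "\<alpha> \<notin> \<rat>" and "k \<noteq> 0"
  shows "of_int k * \<alpha> \<notin> \<rat>"
proof
  assume "of_int k * \<alpha> \<in> \<rat>"
  hence "of_int k * \<alpha> / of_int k \<in> \<rat>" by (intro Rats_divide) auto
  thus False using assms by simp
qed

lemma frac_int_mult_irrational_pos:
  fixes \<alpha> :: real
  assumes "\<alpha> \<notin> \<rat>" and "k \<noteq> 0"
  shows "frac (of_int k * \<alpha>) > 0"
  using irrational_mult_int[OF assms] Ints_subset_Rats by (auto simp: frac_gt_0_iff)

text \<open>Dividing \<open>k\<close> and its floor by \<open>g\<close> gives a primitive vector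
  \<open>(x k, y k)\<close>. The map to \<open>(x k, t k)\<close> has determinant -1, so
  determinants of pairs remain integers up to sign, and the box has sides \<open>n / g\<close> and
  \<open>1 / g\<close>.\<close>

lemma card_gcd_floor_eq_le:
  fixes \<alpha> :: real and g :: int
  assumes "\<alpha> \<notin> \<rat>" and "g > 0" and "n > 0"
  shows "real (card {k \<in> {1..<int n}. gcd \<lfloor>of_int k * \<alpha>\<rfloor> k = g}) \<le> 2 * real n / of_int g ^ 2 + 2"
proof -
  define S where "S = {k \<in> {1..<int n}. gcd \<lfloor>of_int k * \<alpha>\<rfloor> k = g}"
  define x where "x k = k div g" for k
  define y where "y k = \<lfloor>of_int k * \<alpha>\<rfloor> div g" for k
  define t where "t k = frac (of_int k * \<alpha>) / of_int g" for k :: int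
  have xg: "k = g * x k" and yg: "\<lfloor>of_int k * \<alpha>\<rfloor> = g * y k" and cop: "coprime (x k) (y k)"
    and xpos: "x k > 0" if "k \<in> S" for k
  proof -
    have g: "gcd \<lfloor>of_int k * \<alpha>\<rfloor> k = g" and k: "k > 0"
      using that by (auto simp: S_def)
    show 1: "k = g * x k" "\<lfloor>of_int k * \<alpha>\<rfloor> = g * y k"
      unfolding x_def y_def using g by (metis dvd_mult_div_cancel gcd_dvd1 gcd_dvd2)+
    show "coprime (x k) (y k)"
      unfolding x_def y_def using g \<open>g > 0\<close>
      by (metis coprime_commute div_gcd_coprime gcd_eq_0_iff less_irrefl)
    show "x k > 0" using 1 k \<open>g > 0\<close> by (metis zero_less_mult_pos)
  qed
  have t: "t k = of_int (x k) * \<alpha> - of_int (y k)" if "k \<in> S" for k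
  proof -
    have "frac (of_int k * \<alpha>) = of_int k * \<alpha> - of_int \<lfloor>of_int k * \<alpha>\<rfloor>"
      by (simp add: frac_def)
    also have "\<dots> = of_int (g * x k) * \<alpha> - of_int (g * y k)"
      using xg[OF that] yg[OF that] by metis
    also have "\<dots> = of_int g * (of_int (x k) * \<alpha> - of_int (y k))"
      by (simp add: algebra_simps)
    finally show ?thesis using \<open>g > 0\<close> by (simp add: t_def)
  qed
  have "real (card S) \<le> 2 * (real n / of_int g) * (1 / of_int g) + 2"
  proof (rule card_unimodular_vectors_in_box_le)
    fix k assume k: "k \<in> S"
    have "real_of_int (g * x k) \<le> real n"
      using k xg[OF k] by (simp add: S_def)
    hence "real_of_int (x k) \<le> real n / of_int g"
      using \<open>g > 0\<close> by (simp add: field_simps)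
    moreover have "0 < t k"
      using frac_int_mult_irrational_pos[OF assms(1), of k] k \<open>g > 0\<close> by (simp add: t_def S_def)
    moreover have "t k \<le> 1 / of_int g"
      using frac_lt_1[of "of_int k * \<alpha>"] \<open>g > 0\<close> by (simp add: t_def divide_right_mono)
    ultimately show "0 < real_of_int (x k) \<and> real_of_int (x k) \<le> real n / of_int g \<and>
        0 < t k \<and> t k \<le> 1 / of_int g"
      using xpos[OF k] by simp
  next
    fix k l assume kl: "k \<in> S" "l \<in> S" "k \<noteq> l"
    have eq: "of_int (x k) * t l - of_int (x l) * t k = of_int (x l * y k - x k * y l)"
      by (simp add: t kl algebra_simps)
    \<comment> \<open>Parallel primitive vectors with positive first coordinates coincide:
      coprimality makes each first coordinate divide the other, and \<open>k = g * x k\<close>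
      recovers \<open>k\<close>.\<close>
    have "x l * y k - x k * y l \<noteq> 0"
    proof
      assume "x l * y k - x k * y l = 0"
      hence e: "x l * y k = x k * y l" by simp
      have "x l dvd x k"
        using e cop[OF kl(2)] by (metis coprime_dvd_mult_left_iff dvd_triv_left)
      moreover have "x k dvd x l"
        using e cop[OF kl(1)] by (metis coprime_dvd_mult_left_iff dvd_triv_left)
      ultimately have "x k = x l"
        using xpos kl by (simp add: zdvd_antisym_nonneg order.strict_implies_order)
      thus False using xg kl by metis
    qed
    hence "\<bar>x l * y k - x k * y l\<bar> \<ge> 1" by linarith
    thus "1 \<le> \<bar>of_int (x k) * t l - of_int (x l) * t k\<bar>"
      unfolding eq by (simp only: of_int_abs[symmetric] of_int_1_le_iff)
  next
    show "finite S"
      by (simp add: S_def)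
  qed (use assms in auto)
  thus ?thesis by (simp add: S_def power2_eq_square)
qed

section \<open>Tail of the series of inverse squares\<close>

lemma sum_inverse_squares_tail_le:
  assumes "D > 0"
  shows "(\<Sum>g=Suc D..G. 1 / real g ^ 2) \<le> 1 / real D"
proof -
  \<comment> \<open>Telescoping with \<open>1 / (G + 1)^2 \<le> 1 / G - 1 / (G + 1)\<close>. The
    \<open>max\<close> makes the bound 0 while the sum is empty, so that induction on
    \<open>G\<close> can start at 0.\<close>
  have "(\<Sum>g=Suc D..G. 1 / real g ^ 2) \<le> 1 / real D - 1 / real (max D G)"
  proof (induction G)
    case (Suc G)
    show ?case
    proof (cases "D \<le> G")
      case True
      have "1 / real (Suc G) ^ 2 \<le> 1 / real G - 1 / real (Suc G)"
      proof -
        have "1 / real (Suc G) ^ 2 \<le> 1 / (real G * real (Suc G))"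
          using True \<open>D > 0\<close> unfolding power2_eq_square
          by (intro divide_left_mono mult_right_mono) auto
        also have "\<dots> = 1 / real G - 1 / real (Suc G)"
          using True \<open>D > 0\<close> by (simp add: field_simps)
        finally show ?thesis .
      qed
      thus ?thesis using Suc True by (simp add: max_def)
    next
      case False
      hence "Suc G \<le> D" by simp
      thus ?thesis by (simp add: max_absorb1)
    qed
  qed simp
  thus ?thesis by (simp add: order_trans)
qed

section \<open>Growth of the denominators\<close>

text \<open>A denominator at most \<open>B\<close> divides \<open>fact B\<close>, so
  \<open>fact B\<close> times the convergent is an integer. These products tend to an irrational
  number, which keeps a positive distance from all integers, so this happens only finitely
  often.\<close>

lemma cf_denom_at_top:
  assumes "0 < \<alpha>" "\<alpha> < 1" "\<alpha> \<notin> \<rat>"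
  shows "filterlim (\<lambda>n. nat (cf_denom \<alpha> n)) at_top sequentially"
  unfolding filterlim_at_top
proof
  fix B :: nat
  define \<beta> where "\<beta> = of_int (fact B) * \<alpha>"
  \<comment> \<open>The distance from \<open>\<beta>\<close> to the nearest integer.\<close>
  define \<delta> where "\<delta> = min (frac \<beta>) (1 - frac \<beta>)"
  have "\<delta> > 0"
    using frac_int_mult_irrational_pos[OF assms(3), of "fact B"] frac_lt_1[of \<beta>]
    by (simp add: \<delta>_def \<beta>_def)
  have far: "\<bar>of_int z - \<beta>\<bar> \<ge> \<delta>" for z
  proof (cases "z \<le> \<lfloor>\<beta>\<rfloor>")
    case True
    thus ?thesis unfolding \<delta>_def frac_def by linarith
  next
    case False
    hence "real_of_int z \<ge> of_int \<lfloor>\<beta>\<rfloor> + 1" by linarith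
    thus ?thesis unfolding \<delta>_def frac_def by linarith
  qed
  have "(\<lambda>n. of_int (fact B) * real_of_rat (cf_convergent \<alpha> n)) \<longlonglongrightarrow> \<beta>"
    unfolding \<beta>_def by (intro tendsto_intros cf_convergent_tendsto assms)
  hence "\<forall>\<^sub>F n in sequentially. \<bar>of_int (fact B) * real_of_rat (cf_convergent \<alpha> n) - \<beta>\<bar> < \<delta>"
    using tendstoD[of _ \<beta> _ \<delta>] \<open>\<delta> > 0\<close> by (simp add: dist_real_def)
  thus "\<forall>\<^sub>F n in sequentially. B \<le> nat (cf_denom \<alpha> n)"
  proof eventually_elim
    case (elim n)
    obtain p q where pq: "quotient_of (cf_convergent \<alpha> n) = (p, q)" by force
    have q: "q > 0" using quotient_of_denom_pos[OF pq] .
    have r: "real_of_rat (cf_convergent \<alpha> n) = of_int p / of_int q"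
      using quotient_of_div[OF pq] by (simp add: of_rat_divide)
    show ?case
    proof (rule ccontr)
      assume "\<not> ?case"
      hence "nat q \<le> B" using pq by (simp add: cf_denom_def)
      hence "nat q dvd fact B" using q by (intro dvd_fact) auto
      hence "int (nat q) dvd int (fact B)" using int_dvd_int_iff by blast
      hence "q dvd fact B" using q by simp
      then obtain m where m: "fact B = q * m" by (rule dvdE)
      have "of_int (fact B) * real_of_rat (cf_convergent \<alpha> n) = of_int (m * p)"
        using q by (simp add: r m)
      thus False using elim far[of "m * p"] by simp
    qed
  qed
qed

section \<open>Densities\<close>

text \<open>The half-open range \<open>{1..<int n}\<close> is the range of \<open>J\<close> when
  \<open>n\<close> is the denominator bounding it, so a density can be evaluated along the
  denominators directly.\<close>

definition has_density :: "(int \<Rightarrow> bool) \<Rightarrow> real \<Rightarrow> bool" where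
  "has_density P x \<longleftrightarrow> (\<lambda>n. real (card {k \<in> {1..<int n}. P k}) / real n) \<longlonglongrightarrow> x"

lemma has_density_cong:
  assumes "\<And>k. k \<ge> 1 \<Longrightarrow> P k \<longleftrightarrow> Q k"
  shows "has_density P x \<longleftrightarrow> has_density Q x"
proof -
  have "{k \<in> {1..<int n}. P k} = {k \<in> {1..<int n}. Q k}" for n
    using assms by auto
  thus ?thesis by (simp add: has_density_def)
qed

lemma has_density_diff:
  assumes "has_density P x" and "has_density Q y" and "\<And>k. Q k \<Longrightarrow> P k"
  shows "has_density (\<lambda>k. P k \<and> \<not> Q k) (x - y)"
proof -
  have "real (card {k \<in> {1..<int n}. P k \<and> \<not> Q k}) / real n =
      real (card {k \<in> {1..<int n}. P k}) / real n - real (card {k \<in> {1..<int n}. Q k}) / real n" for n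
  proof -
    have "{k \<in> {1..<int n}. P k \<and> \<not> Q k} = {k \<in> {1..<int n}. P k} - {k \<in> {1..<int n}. Q k}"
      by auto
    moreover have sub: "{k \<in> {1..<int n}. Q k} \<subseteq> {k \<in> {1..<int n}. P k}"
      using assms(3) by auto
    ultimately show ?thesis
      by (simp add: card_Diff_subset card_mono of_nat_diff diff_divide_distrib)
  qed
  thus ?thesis
    using assms(1,2) unfolding has_density_def by (simp add: tendsto_diff)
qed

text \<open>The counted multiples \<open>d * l\<close> below \<open>n\<close> correspond to the
  \<open>l\<close> below \<open>m n\<close>, the ceiling of \<open>n / d\<close>. The density of
  \<open>P\<close> is taken along \<open>m n\<close>, which tends to infinity, and
  \<open>m n / n\<close> tends to \<open>1 / d\<close>.\<close>

lemma has_density_dilate: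
  assumes "has_density P x" and "d \<ge> 1"
  shows "has_density (\<lambda>k. d dvd k \<and> P (k div d)) (x / of_int d)"
proof -
  define m where "m n = nat \<lceil>real n / of_int d\<rceil>" for n
  have m: "real n / of_int d \<le> real (m n)" "real (m n) \<le> real n / of_int d + 1" for n
  proof -
    have "real n / of_int d \<ge> 0" using assms(2) by simp
    thus "real n / of_int d \<le> real (m n)" "real (m n) \<le> real n / of_int d + 1"
      unfolding m_def by linarith+
  qed
  have card: "card {k \<in> {1..<int n}. d dvd k \<and> P (k div d)} = card {k \<in> {1..<int (m n)}. P k}" for n
  proof (rule bij_betw_same_card[symmetric], rule bij_betwI[where f = "\<lambda>k. d * k" and g = "\<lambda>k. k div d"])
    have iff: "d * k < int n \<longleftrightarrow> k < int (m n)" for k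
    proof -
      have "d * k < int n \<longleftrightarrow> of_int (d * k) < real n"
        by (simp only: of_int_less_iff[symmetric, where ?'a = real] of_int_of_nat_eq)
      also have "\<dots> \<longleftrightarrow> of_int k < real n / of_int d"
        using assms(2) by (simp add: field_simps)
      also have "\<dots> \<longleftrightarrow> k < int (m n)"
        using assms(2) divide_nonneg_pos[of "real n" "of_int d"] unfolding m_def by linarith
      finally show ?thesis .
    qed
    show "(\<lambda>k. d * k) \<in> {k \<in> {1..<int (m n)}. P k} \<rightarrow> {k \<in> {1..<int n}. d dvd k \<and> P (k div d)}"
      using assms(2) iff by (auto simp: Suc_le_eq int_one_le_iff_zero_less)
    show "(\<lambda>k. k div d) \<in> {k \<in> {1..<int n}. d dvd k \<and> P (k div d)} \<rightarrow> {k \<in> {1..<int (m n)}. P k}"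
    proof
      fix k assume k: "k \<in> {k \<in> {1..<int n}. d dvd k \<and> P (k div d)}"
      then obtain l where l: "k = d * l" by (auto elim: dvdE)
      moreover have "l \<ge> 1"
        using k assms(2) l by (simp add: int_one_le_iff_zero_less zero_less_mult_iff)
      ultimately show "k div d \<in> {k \<in> {1..<int (m n)}. P k}"
        using k assms(2) iff[of l] by auto
    qed
  qed (use assms(2) in auto)
  have lim_m: "(\<lambda>n. real (m n) / real n) \<longlonglongrightarrow> 1 / of_int d"
  proof (rule tendsto_sandwich)
    show "(\<lambda>n. 1 / real_of_int d) \<longlonglongrightarrow> 1 / real_of_int d" by simp
    have "(\<lambda>n. 1 / real_of_int d + 1 / real n) \<longlonglongrightarrow> 1 / real_of_int d + 0"
      by (intro tendsto_intros lim_1_over_n)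
    thus "(\<lambda>n. 1 / real_of_int d + 1 / real n) \<longlonglongrightarrow> 1 / real_of_int d" by simp
    show "\<forall>\<^sub>F n in sequentially. 1 / real_of_int d \<le> real (m n) / real n"
      using eventually_gt_at_top[of 0]
    proof eventually_elim
      case (elim n)
      thus ?case using divide_right_mono[OF m(1)[of n], of "real n"] by simp
    qed
    show "\<forall>\<^sub>F n in sequentially. real (m n) / real n \<le> 1 / real_of_int d + 1 / real n"
      using eventually_gt_at_top[of 0]
    proof eventually_elim
      case (elim n)
      thus ?case using divide_right_mono[OF m(2)[of n], of "real n"] by (simp add: add_divide_distrib)
    qed
  qed
  have "filterlim (\<lambda>n. real (m n)) at_top sequentially"
  proof (rule filterlim_at_top_mono)
    show "filterlim (\<lambda>n. 1 / real_of_int d * real n) at_top sequentially"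
      using assms(2) by (intro filterlim_tendsto_pos_mult_at_top[OF tendsto_const]
        filterlim_real_sequentially) auto
    show "\<forall>\<^sub>F n in sequentially. 1 / real_of_int d * real n \<le> real (m n)"
      using m(1) by (intro always_eventually) simp
  qed
  hence m_inf: "filterlim m at_top sequentially"
    by (simp add: filterlim_sequentially_iff_filterlim_real)
  have "(\<lambda>n. real (card {k \<in> {1..<int (m n)}. P k}) / real (m n) * (real (m n) / real n))
      \<longlonglongrightarrow> x * (1 / of_int d)"
    using assms(1) m_inf lim_m unfolding has_density_def
    by (intro tendsto_mult) (auto intro: filterlim_compose)
  \<comment> \<open>If \<open>m n = 0\<close>, the range is empty and both sides are 0; otherwise
    \<open>m n\<close> cancels.\<close>
  moreover have "real (card {k \<in> {1..<int (m n)}. P k}) / real (m n) * (real (m n) / real n) =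
      real (card {k \<in> {1..<int n}. d dvd k \<and> P (k div d)}) / real n" for n
    unfolding card by (cases "m n = 0") auto
  ultimately show ?thesis
    unfolding has_density_def by (simp only: times_divide_eq_right mult_1_right)
qed

section \<open>Equidistribution of rotations\<close>

lemma card_int_between_le:
  fixes x y :: real
  assumes "finite U" and "\<And>z. z \<in> U \<Longrightarrow> x \<le> of_int z \<and> of_int z \<le> y" and "x \<le> y"
  shows "real (card (U :: int set)) \<le> y - x + 1"
proof -
  have "real (card U) \<le> (y - x) / 1 + 1"
  proof (rule card_separated_reals_le)
    fix k l :: int assume "k \<noteq> l"
    hence "1 \<le> \<bar>k - l\<bar>" by linarith
    thus "1 \<le> \<bar>real_of_int k - real_of_int l\<bar>" by linarith
  qed (use assms in auto)
  thus ?thesis by simp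
qed

text \<open>Over \<open>q\<close> consecutive values of \<open>k\<close>, the rotation by
  \<open>\<alpha>\<close> stays close to that by \<open>p / q\<close>. The integer
  \<open>u k\<close> is congruent to \<open>(k - c) * p\<close> modulo \<open>q\<close>, hence
  determines \<open>k\<close>, and differs by at most 1 from
  \<open>q * (frac (k * \<alpha>) - c * \<alpha>)\<close>. The images thus lie in an interval of
  length \<open>q * (b - a) + 2\<close>, which contains at most one integer more than its
  length.\<close>

lemma card_rotation_block_le:
  fixes \<alpha> a b :: real and p q c :: int
  assumes "q > 0" and "coprime p q" and "\<bar>\<alpha> - of_int p / of_int q\<bar> \<le> 1 / of_int q ^ 2" and "a \<le> b"
  shows "real (card {k \<in> {c..<c + q}. frac (of_int k * \<alpha>) \<in> {a..b}}) \<le> of_int q * (b - a) + 3"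
proof -
  define S where "S = {k \<in> {c..<c + q}. frac (of_int k * \<alpha>) \<in> {a..b}}"
  define u where "u k = (k - c) * p - q * \<lfloor>of_int k * \<alpha>\<rfloor>" for k
  have "inj_on u S"
  proof (rule inj_onI)
    fix k l assume kl: "k \<in> S" "l \<in> S" "u k = u l"
    have "(k - l) * p = q * (\<lfloor>of_int k * \<alpha>\<rfloor> - \<lfloor>of_int l * \<alpha>\<rfloor>)"
      using kl(3) by (simp add: u_def algebra_simps)
    hence "q dvd (k - l) * p" by simp
    hence "q dvd k - l"
      using assms(2) by (simp add: coprime_commute coprime_dvd_mult_left_iff)
    moreover have "\<bar>k - l\<bar> < q" using kl by (auto simp: S_def)
    ultimately show "k = l" using dvd_imp_le_int[of "k - l" q] by force
  qed
  hence "card S = card (u ` S)" by (simp add: card_image)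
  also have "real (card (u ` S)) \<le>
      (of_int q * (b - of_int c * \<alpha>) + 1) - (of_int q * (a - of_int c * \<alpha>) - 1) + 1"
  proof (rule card_int_between_le)
    fix z assume "z \<in> u ` S"
    then obtain k where k: "k \<in> S" "z = u k" by blast
    define \<eta> where "\<eta> = \<alpha> - of_int p / of_int q"
    have eq: "of_int z = of_int q * (frac (of_int k * \<alpha>) - of_int c * \<alpha>) - of_int (k - c) * (of_int q * \<eta>)"
      using assms(1) by (simp add: k u_def frac_def \<eta>_def field_simps)
    have "\<bar>of_int (k - c) * (of_int q * \<eta>)\<bar> = \<bar>of_int (k - c)\<bar> * (of_int q * \<bar>\<eta>\<bar>)"
      using assms(1) by (simp add: abs_mult)
    also have "\<dots> \<le> of_int q * (of_int q * (1 / of_int q ^ 2))"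
      using k assms(1,3) by (intro mult_mono) (auto simp: S_def \<eta>_def)
    also have "\<dots> = 1" using assms(1) by (simp add: power2_eq_square)
    finally have err: "\<bar>of_int (k - c) * (of_int q * \<eta>)\<bar> \<le> 1" .
    have "of_int q * (a - of_int c * \<alpha>) \<le> of_int q * (frac (of_int k * \<alpha>) - of_int c * \<alpha>)"
      "of_int q * (frac (of_int k * \<alpha>) - of_int c * \<alpha>) \<le> of_int q * (b - of_int c * \<alpha>)"
      using k assms(1) by (auto simp: S_def)
    thus "of_int q * (a - of_int c * \<alpha>) - 1 \<le> of_int z \<and> of_int z \<le> of_int q * (b - of_int c * \<alpha>) + 1"
      using eq err by linarith
  next
    have "of_int q * (a - of_int c * \<alpha>) \<le> of_int q * (b - of_int c * \<alpha>)"
      using assms(1,4) by simp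
    thus "of_int q * (a - of_int c * \<alpha>) - 1 \<le> of_int q * (b - of_int c * \<alpha>) + 1"
      by linarith
  qed (simp add: S_def)
  finally show ?thesis by (simp add: S_def algebra_simps)
qed

lemma card_rotation_blocks_le:
  fixes \<alpha> a b :: real and p q :: int and j :: nat
  assumes "q > 0" and "coprime p q" and "\<bar>\<alpha> - of_int p / of_int q\<bar> \<le> 1 / of_int q ^ 2" and "a \<le> b"
  shows "real (card {k \<in> {0..<int j * q}. frac (of_int k * \<alpha>) \<in> {a..b}}) \<le> real j * (of_int q * (b - a) + 3)"
proof (induction j)
  case (Suc j)
  let ?S = "\<lambda>x y. {k \<in> {x..<y}. frac (of_int k * \<alpha>) \<in> {a..b}}"
  have "?S 0 (int (Suc j) * q) = ?S 0 (int j * q) \<union> ?S (int j * q) (int j * q + q)"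
    using \<open>q > 0\<close> by (auto simp: algebra_simps) (smt (verit) mult_nonneg_nonneg of_nat_0_le_iff)+
  hence "card (?S 0 (int (Suc j) * q)) \<le> card (?S 0 (int j * q)) + card (?S (int j * q) (int j * q + q))"
    by (simp only: card_Un_le)
  moreover note Suc card_rotation_block_le[OF assms, of "int j * q"]
  ultimately show ?case by (simp add: algebra_simps)
qed simp

text \<open>Dirichlet approximation supplies arbitrarily large \<open>q\<close> for the block
  estimate. With \<open>q > 6 / \<epsilon>\<close> the excess 3 per block costs at most
  \<open>\<epsilon> / 2\<close> in density; the incomplete last block costs \<open>C / n\<close>,
  which tends to 0.\<close>

lemma rotation_upper_density:
  fixes \<alpha> a b \<epsilon> :: real
  assumes "\<alpha> \<notin> \<rat>" and "a \<le> b" and "\<epsilon> > 0"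
  shows "\<forall>\<^sub>F n in sequentially.
    real (card {k \<in> {1..<int n}. frac (of_int k * \<alpha>) \<in> {a..b}}) / real n \<le> b - a + \<epsilon>"
proof -
  have "infinite (approx_set \<alpha>)"
    using assms(1) rational_iff_finite_approx_set by blast
  then obtain p q where pq: "(p, q) \<in> approx_set \<alpha>" and big: "q > \<lceil>6 / \<epsilon>\<rceil>"
    using infinite_approx_set by blast
  have q: "q > 0" "coprime p q" "\<bar>\<alpha> - of_int p / of_int q\<bar> \<le> 1 / of_int q ^ 2"
    using pq by (auto simp: approx_set_def)
  have "6 / \<epsilon> < of_int q" using big by linarith
  hence small: "3 / of_int q \<le> \<epsilon> / 2"
    using q(1) assms(3) by (simp add: field_simps)
  define C where "C = of_int q * (b - a) + 3"
  have "C \<ge> 0" using q(1) assms(2) by (simp add: C_def)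
  have "(\<lambda>n. C / real n) \<longlonglongrightarrow> 0" by (rule lim_const_over_n)
  hence "\<forall>\<^sub>F n in sequentially. C / real n < \<epsilon> / 2"
    using assms(3) by (intro order_tendstoD) auto
  with eventually_gt_at_top[of 0] show ?thesis
  proof eventually_elim
    case (elim n)
    \<comment> \<open>One block more than fit into \<open>n\<close>, so that the blocks cover the
      whole range.\<close>
    define j where "j = Suc (n div nat q)"
    have "n < j * nat q"
      using q(1) dividend_less_div_times[of "nat q" n] by (simp add: j_def algebra_simps)
    hence "int n < int (j * nat q)" by (simp only: of_nat_less_iff)
    hence "int n \<le> int j * q" using q(1) by simp
    hence "{k \<in> {1..<int n}. frac (of_int k * \<alpha>) \<in> {a..b}}
        \<subseteq> {k \<in> {0..<int j * q}. frac (of_int k * \<alpha>) \<in> {a..b}}" by auto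
    hence "card {k \<in> {1..<int n}. frac (of_int k * \<alpha>) \<in> {a..b}} \<le>
        card {k \<in> {0..<int j * q}. frac (of_int k * \<alpha>) \<in> {a..b}}" by (intro card_mono) auto
    hence "real (card {k \<in> {1..<int n}. frac (of_int k * \<alpha>) \<in> {a..b}}) \<le> real j * C"
      unfolding C_def using card_rotation_blocks_le[OF q assms(2), of j] by linarith
    also have "real j \<le> real n / of_int q + 1"
      using q(1) of_nat_div_le_of_nat[of n "nat q", where ?'a = real] by (simp add: j_def)
    hence "real j * C \<le> (real n / of_int q + 1) * C"
      using \<open>C \<ge> 0\<close> by (rule mult_right_mono)
    also have "\<dots> = real n * (b - a + 3 / of_int q) + C"
      using q(1) by (simp add: C_def field_simps)
    finally have "real (card {k \<in> {1..<int n}. frac (of_int k * \<alpha>) \<in> {a..b}}) / real n \<le>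
        (b - a + 3 / of_int q) + C / real n"
      using elim(1) by (simp add: field_simps)
    thus ?case using small elim(2) by linarith
  qed
qed

text \<open>Upper bounds suffice: applied to \<open>{0..a}\<close> and \<open>{b..1}\<close>, which
  cover the complement of \<open>I\<close> in the unit interval, they give the lower bound for
  \<open>I\<close>. The two inclusions treat open, closed and half-open intervals at once.\<close>

lemma has_density_rotation:
  fixes \<alpha> a b :: real
  assumes "\<alpha> \<notin> \<rat>" and "0 \<le> a" "a \<le> b" "b \<le> 1" and "{a<..<b} \<subseteq> I" "I \<subseteq> {a..b}"
  shows "has_density (\<lambda>k. frac (of_int k * \<alpha>) \<in> I) (b - a)"
  unfolding has_density_def
proof (rule order_tendstoI)
  let ?c = "\<lambda>A n. real (card {k \<in> {1..<int n}. frac (of_int k * \<alpha>) \<in> A})"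
  have mono: "?c A n \<le> ?c B n" if "A \<subseteq> B" for A B n
    using that by (intro of_nat_mono card_mono) auto
  {
    fix y assume "b - a < y"
    hence "\<forall>\<^sub>F n in sequentially. ?c {a..b} n / real n \<le> b - a + (y - (b - a)) / 2"
      using assms by (intro rotation_upper_density) auto
    thus "\<forall>\<^sub>F n in sequentially. ?c I n / real n < y"
    proof eventually_elim
      case (elim n)
      have "?c I n / real n \<le> ?c {a..b} n / real n"
        using mono[OF assms(6)] by (intro divide_right_mono) auto
      also note elim
      also have "b - a + (y - (b - a)) / 2 < y" using \<open>b - a < y\<close> by (simp add: field_simps)
      finally show ?case .
    qed
  next
    fix y assume y: "y < b - a"
    \<comment> \<open>Three errors of size \<open>\<epsilon>\<close> occur, from the two
      complementary intervals and from the \<open>n - 1\<close> integers in the range; the fourth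
      part keeps the inequality strict.\<close>
    define \<epsilon> where "\<epsilon> = (b - a - y) / 4"
    have "\<epsilon> > 0" using y by (simp add: \<epsilon>_def)
    have "\<forall>\<^sub>F n in sequentially. ?c {0..a} n / real n \<le> a - 0 + \<epsilon>"
      "\<forall>\<^sub>F n in sequentially. ?c {b..1} n / real n \<le> 1 - b + \<epsilon>"
      using assms \<open>\<epsilon> > 0\<close> by (intro rotation_upper_density; simp)+
    moreover have "\<forall>\<^sub>F n in sequentially. 1 / real n < \<epsilon>"
      using \<open>\<epsilon> > 0\<close> by (intro order_tendstoD[OF lim_1_over_n]) auto
    ultimately show "\<forall>\<^sub>F n in sequentially. y < ?c I n / real n"
      using eventually_gt_at_top[of 0]
    proof eventually_elim
      case (elim n)
      let ?S = "\<lambda>A. {k \<in> {1..<int n}. frac (of_int k * \<alpha>) \<in> A}"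
      have "frac x \<in> I \<or> frac x \<in> {0..a} \<or> frac x \<in> {b..1}" for x :: real
        using assms(5) frac_ge_0[of x] frac_lt_1[of x] by force
      hence "{1..<int n} \<subseteq> ?S I \<union> (?S {0..a} \<union> ?S {b..1})" by blast
      hence "card {1..<int n} \<le> card (?S I \<union> (?S {0..a} \<union> ?S {b..1}))"
        by (intro card_mono) auto
      also have "\<dots> \<le> card (?S I) + (card (?S {0..a}) + card (?S {b..1}))"
        by (intro order_trans[OF card_Un_le] add_mono card_Un_le order_refl)
      finally have "real n - 1 \<le> ?c I n + (?c {0..a} n + ?c {b..1} n)"
        using elim by simp
      hence "(real n - 1) / real n \<le> (?c I n + (?c {0..a} n + ?c {b..1} n)) / real n"
        by (intro divide_right_mono) auto
      hence "1 - 1 / real n \<le> ?c I n / real n + (?c {0..a} n / real n + ?c {b..1} n / real n)"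
        using elim by (simp add: add_divide_distrib diff_divide_distrib)
      moreover have "4 * \<epsilon> = b - a - y" by (simp add: \<epsilon>_def)
      ultimately show ?case using elim(1-3) \<open>\<epsilon> > 0\<close> by linarith
    qed
  }
qed

section \<open>Sieving by finitely many primes\<close>

text \<open>Write \<open>k * \<alpha> = d * x\<close>. If the floor of \<open>d * x\<close> is
  \<open>d * l\<close>, then \<open>x = l + f / d\<close> with \<open>f = frac (d * x)\<close>;
  conversely \<open>frac x = f / d\<close> with \<open>0 \<le> f < 1\<close> gives
  \<open>d * x = d * \<lfloor>x\<rfloor> + f\<close>. Divisibility by \<open>d\<close> thus becomes
  a condition on the rotation at \<open>k div d\<close>.\<close>

lemma dvd_floor_and_frac_in_iff:
  fixes \<alpha> :: real and d k :: int
  assumes "d \<ge> 1" and "d dvd k" and "I \<subseteq> {0..<1}"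
  shows "d dvd \<lfloor>of_int k * \<alpha>\<rfloor> \<and> frac (of_int k * \<alpha>) \<in> I \<longleftrightarrow>
    frac (of_int (k div d) * \<alpha>) \<in> (\<lambda>x. x / of_int d) ` I"
proof -
  define x where "x = of_int (k div d) * \<alpha>"
  have kx: "of_int k * \<alpha> = of_int d * x"
    using assms(1,2) by (auto simp: x_def elim!: dvdE)
  show ?thesis
    unfolding kx x_def[symmetric]
  proof
    assume *: "d dvd \<lfloor>of_int d * x\<rfloor> \<and> frac (of_int d * x) \<in> I"
    then obtain l where l: "\<lfloor>of_int d * x\<rfloor> = d * l" by (auto elim: dvdE)
    define f where "f = frac (of_int d * x)"
    have f: "0 \<le> f" "f < 1" by (simp_all add: f_def frac_lt_1)
    have "of_int d * x = of_int d * of_int l + f"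
      using l by (simp add: f_def frac_def)
    hence x: "x = of_int l + f / of_int d"
      using assms(1) by (simp add: field_simps)
    have "f / of_int d < 1" using f assms(1) by (simp add: field_simps)
    hence "frac x = f / of_int d"
      using f assms(1) unfolding x by (simp add: frac_unique_iff)
    thus "frac x \<in> (\<lambda>x. x / of_int d) ` I" using * by (auto simp: f_def)
  next
    assume "frac x \<in> (\<lambda>x. x / of_int d) ` I"
    then obtain f where f: "f \<in> I" "frac x = f / of_int d" by auto
    have "of_int d * x = of_int (d * \<lfloor>x\<rfloor>) + of_int d * frac x"
      by (simp add: frac_def algebra_simps)
    hence e: "of_int d * x = of_int (d * \<lfloor>x\<rfloor>) + f"
      using f assms(1) by simp
    have "0 \<le> f" "f < 1" using f assms(3) by auto
    hence "frac (of_int d * x) = f" "\<lfloor>of_int d * x\<rfloor> = d * \<lfloor>x\<rfloor>"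
      unfolding e by (simp_all add: frac_unique_iff floor_eq_iff del: of_int_mult)
    thus "d dvd \<lfloor>of_int d * x\<rfloor> \<and> frac (of_int d * x) \<in> I" using f by simp
  qed
qed

text \<open>One factor \<open>1 / d\<close> comes from shrinking the interval, the other from
  passing to the multiples of \<open>d\<close>.\<close>

lemma has_density_common_divisor:
  fixes \<alpha> a b :: real and d :: int
  assumes "\<alpha> \<notin> \<rat>" and "0 \<le> a" "a \<le> b" "b \<le> 1" and "{a<..<b} \<subseteq> I" "I \<subseteq> {a..b}" "I \<subseteq> {0..<1}"
    and "d \<ge> 1"
  shows "has_density (\<lambda>k. frac (of_int k * \<alpha>) \<in> I \<and> d dvd k \<and> d dvd \<lfloor>of_int k * \<alpha>\<rfloor>)
    ((b - a) / of_int d ^ 2)"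
proof -
  have d: "real_of_int d \<ge> 1" using assms(8) by simp
  have "has_density (\<lambda>k. frac (of_int k * \<alpha>) \<in> (\<lambda>x. x / of_int d) ` I) (b / of_int d - a / of_int d)"
  proof (rule has_density_rotation)
    show "{a / of_int d<..<b / of_int d} \<subseteq> (\<lambda>x. x / of_int d) ` I"
    proof
      fix x assume "x \<in> {a / of_int d<..<b / of_int d}"
      hence "x * of_int d \<in> I" using assms(5) d by (auto simp: field_simps)
      thus "x \<in> (\<lambda>x. x / of_int d) ` I" using d by (intro image_eqI[of _ _ "x * of_int d"]) auto
    qed
    show "b / of_int d \<le> 1" using assms(4) d by (simp add: field_simps)
  qed (use assms d in \<open>auto simp: divide_right_mono\<close>)
  from has_density_dilate[OF this assms(8)]
  have "has_density (\<lambda>k. d dvd k \<and> frac (of_int (k div d) * \<alpha>) \<in> (\<lambda>x. x / of_int d) ` I)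
      ((b - a) / of_int d ^ 2)"
    by (simp add: power2_eq_square diff_divide_distrib)
  also have "?this \<longleftrightarrow> ?thesis"
    using dvd_floor_and_frac_in_iff[OF assms(8) _ assms(7), of _ \<alpha>] by (intro has_density_cong) auto
  finally show ?thesis .
qed

text \<open>The auxiliary modulus \<open>d\<close> makes inclusion-exclusion inductive: sieving by a
  further prime \<open>p\<close> subtracts the same density taken at \<open>p * d\<close>, since
  coprimality turns divisibility by \<open>p\<close> and by \<open>d\<close> into divisibility by
  the product.\<close>

lemma has_density_sieve:
  fixes \<alpha> a b :: real and d :: nat
  assumes "\<alpha> \<notin> \<rat>" and "0 \<le> a" "a \<le> b" "b \<le> 1" and "{a<..<b} \<subseteq> I" "I \<subseteq> {a..b}" "I \<subseteq> {0..<1}"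
    and "finite P" "\<And>p. p \<in> P \<Longrightarrow> prime p" and "d > 0" "\<And>p. p \<in> P \<Longrightarrow> coprime p d"
  shows "has_density (\<lambda>k. (frac (of_int k * \<alpha>) \<in> I \<and> int d dvd gcd \<lfloor>of_int k * \<alpha>\<rfloor> k) \<and>
      (\<forall>p\<in>P. \<not> int p dvd gcd \<lfloor>of_int k * \<alpha>\<rfloor> k))
    ((b - a) / real d ^ 2 * (\<Prod>p\<in>P. 1 - 1 / real p ^ 2))"
  using assms(8-11)
proof (induction P arbitrary: d rule: finite_induct)
  case empty
  have "int d \<ge> 1" using empty by simp
  from has_density_common_divisor[OF assms(1-7) this] show ?case
    by (simp add: conj_commute)
next
  case (insert p P)
  let ?g = "\<lambda>k. gcd \<lfloor>of_int k * \<alpha>\<rfloor> k" and ?w = "\<Prod>p\<in>P. 1 - 1 / real p ^ 2"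
  let ?A = "\<lambda>d k. (frac (of_int k * \<alpha>) \<in> I \<and> int d dvd ?g k) \<and> (\<forall>p\<in>P. \<not> int p dvd ?g k)"
  have p: "prime p" and cop: "coprime p d" using insert.prems by auto
  have cop_pd: "coprime q (p * d)" if "q \<in> P" for q
  proof -
    have "q \<noteq> p" "prime q" using that insert by auto
    thus ?thesis using p that insert.prems by (simp add: primes_coprime)
  qed
  have dvd_iff: "int (p * d) dvd z \<longleftrightarrow> int p dvd z \<and> int d dvd z" for z
  proof
    have "coprime (int p) (int d)" using cop by simp
    thus "int p dvd z \<and> int d dvd z \<Longrightarrow> int (p * d) dvd z" by (simp add: divides_mult)
  qed (auto dest: dvd_mult_left dvd_mult_right)
  have "has_density (?A d) ((b - a) / real d ^ 2 * ?w)"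
    using insert by (intro insert.IH) auto
  moreover have "has_density (?A (p * d)) ((b - a) / real (p * d) ^ 2 * ?w)"
    using insert p cop_pd by (intro insert.IH) (auto simp: prime_gt_0_nat)
  ultimately have "has_density (\<lambda>k. ?A d k \<and> \<not> ?A (p * d) k)
      ((b - a) / real d ^ 2 * ?w - (b - a) / real (p * d) ^ 2 * ?w)"
    by (rule has_density_diff) (unfold dvd_iff, blast)
  also have "(b - a) / real d ^ 2 * ?w - (b - a) / real (p * d) ^ 2 * ?w =
      (b - a) / real d ^ 2 * (\<Prod>p\<in>insert p P. 1 - 1 / real p ^ 2)"
    using insert.hyps by (simp add: power_mult_distrib algebra_simps)
  also have "has_density (\<lambda>k. ?A d k \<and> \<not> ?A (p * d) k) = has_density (\<lambda>k.
      (frac (of_int k * \<alpha>) \<in> I \<and> int d dvd ?g k) \<and> (\<forall>p\<in>insert p P. \<not> int p dvd ?g k))"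
    unfolding dvd_iff by (intro arg_cong[where f = has_density] ext) blast
  finally show ?case .
qed

section \<open>Large common divisors\<close>

text \<open>A common divisor of \<open>k\<close> and \<open>\<lfloor>k \<alpha>\<rfloor>\<close> exceeding \<open>\<epsilon> n\<close> would give a fraction approximating \<open>\<alpha>\<close>
  whose denominator is bounded in terms of \<open>\<epsilon>\<close> alone, with an error tending to 0.\<close>

lemma eventually_gcd_floor_le:
  fixes \<alpha> \<epsilon> :: real
  assumes "\<alpha> \<notin> \<rat>" and "\<epsilon> > 0"
  shows "\<forall>\<^sub>F n in sequentially. \<forall>k\<in>{1..<int n}. of_int (gcd \<lfloor>of_int k * \<alpha>\<rfloor> k) \<le> \<epsilon> * real n"
proof -
  \<comment> \<open>If \<open>k = g * q < n\<close> with \<open>g > \<epsilon> * n\<close>, then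
    \<open>q < 1 / \<epsilon>\<close>, so only the finitely many \<open>q\<close> in
    \<open>Q\<close> occur and \<open>\<delta>\<close> bounds their fractional parts from
    below.\<close>
  define Q where "Q = {1..\<lceil>1 / \<epsilon>\<rceil>}"
  define \<delta> where "\<delta> = Min ((\<lambda>q. frac (of_int q * \<alpha>)) ` Q)"
  have ne: "Q \<noteq> {}" using assms(2) by (simp add: Q_def)
  have "\<delta> > 0"
    using ne frac_int_mult_irrational_pos[OF assms(1)] by (auto simp: \<delta>_def Q_def)
  have "filterlim (\<lambda>n. \<epsilon> * real n) at_top sequentially"
    using assms(2) by (intro filterlim_tendsto_pos_mult_at_top[OF tendsto_const]
        filterlim_real_sequentially)
  hence "\<forall>\<^sub>F n in sequentially. 1 / \<delta> < \<epsilon> * real n"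
    by (simp add: filterlim_at_top_dense)
  with eventually_gt_at_top[of 0] show ?thesis
  proof eventually_elim
    case (elim n)
    show ?case
    proof
      fix k assume k: "k \<in> {1..<int n}"
      define g where "g = gcd \<lfloor>of_int k * \<alpha>\<rfloor> k"
      show "of_int (gcd \<lfloor>of_int k * \<alpha>\<rfloor> k) \<le> \<epsilon> * real n"
      proof (rule ccontr)
        assume "\<not> of_int (gcd \<lfloor>of_int k * \<alpha>\<rfloor> k) \<le> \<epsilon> * real n"
        hence g: "of_int g > \<epsilon> * real n" by (simp add: g_def)
        have "g \<ge> 1" using k by (simp add: g_def int_one_le_iff_zero_less)
        have "g dvd k" "g dvd \<lfloor>of_int k * \<alpha>\<rfloor>" by (simp_all add: g_def)
        then obtain q where q: "k = g * q" by (auto elim: dvdE)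
        have "q \<ge> 1" using q k \<open>g \<ge> 1\<close>
          by (simp add: int_one_le_iff_zero_less zero_less_mult_iff)
        have "\<epsilon> * real n * of_int q \<le> of_int g * of_int q"
          using g \<open>q \<ge> 1\<close> by (intro mult_right_mono) auto
        also have "\<dots> = of_int k" by (simp add: q)
        also have "\<dots> \<le> real n" using k by simp
        finally have "of_int q \<le> 1 / \<epsilon>" using elim(1) assms(2) by (simp add: field_simps)
        hence "q \<in> Q" using \<open>q \<ge> 1\<close> by (simp add: Q_def) linarith
        hence "\<delta> \<le> frac (of_int q * \<alpha>)" by (simp add: \<delta>_def Q_def)
        \<comment> \<open>Divisibility of the floor by \<open>g\<close> places the fractional part
          in the unit interval shrunk by \<open>g\<close>.\<close>
        moreover have "frac (of_int q * \<alpha>) \<le> 1 / of_int g"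
          using dvd_floor_and_frac_in_iff[OF \<open>g \<ge> 1\<close> \<open>g dvd k\<close>, of "{0..<1}" \<alpha>]
            \<open>g dvd \<lfloor>of_int k * \<alpha>\<rfloor>\<close> \<open>g \<ge> 1\<close> q
          by (auto simp: frac_lt_1 divide_right_mono)
        ultimately have "\<delta> \<le> 1 / of_int g" by linarith
        hence "of_int g \<le> 1 / \<delta>" using \<open>\<delta> > 0\<close> \<open>g \<ge> 1\<close> by (simp add: field_simps)
        thus False using elim(2) g by linarith
      qed
    qed
  qed
qed

text \<open>The bound \<open>2 * n / g^2 + 2\<close> is summed over the possible \<open>g\<close>.
  The main terms form a tail of the inverse squares; the constants 2 are harmless because at most
  \<open>\<epsilon> * n\<close> values of \<open>g\<close> remain.\<close>

lemma eventually_card_large_gcd_le: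
  fixes \<alpha> \<epsilon> :: real and D :: nat
  assumes "\<alpha> \<notin> \<rat>" and "\<epsilon> > 0" and "D > 0"
  shows "\<forall>\<^sub>F n in sequentially.
    real (card {k \<in> {1..<int n}. gcd \<lfloor>of_int k * \<alpha>\<rfloor> k > int D}) / real n \<le> 2 / real D + 2 * \<epsilon>"
  using eventually_gcd_floor_le[OF assms(1,2)] eventually_gt_at_top[of 0]
proof eventually_elim
  case (elim n)
  define G where "G = nat \<lfloor>\<epsilon> * real n\<rfloor>"
  have G: "real G \<le> \<epsilon> * real n" using assms(2) by (simp add: G_def)
  let ?S = "\<lambda>g. {k \<in> {1..<int n}. gcd \<lfloor>of_int k * \<alpha>\<rfloor> k = int g}"
  have "{k \<in> {1..<int n}. gcd \<lfloor>of_int k * \<alpha>\<rfloor> k > int D} \<subseteq> (\<Union>g\<in>{Suc D..G}. ?S g)"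
  proof
    fix k assume k: "k \<in> {k \<in> {1..<int n}. gcd \<lfloor>of_int k * \<alpha>\<rfloor> k > int D}"
    define g where "g = nat (gcd \<lfloor>of_int k * \<alpha>\<rfloor> k)"
    have g: "gcd \<lfloor>of_int k * \<alpha>\<rfloor> k = int g" by (simp add: g_def)
    have "real_of_int (int g) \<le> \<epsilon> * real n" using elim(1) k g by (metis (lifting) mem_Collect_eq)
    hence "g \<le> G" by (simp add: G_def le_nat_floor)
    moreover have "g \<ge> Suc D" using k g by simp
    ultimately show "k \<in> (\<Union>g\<in>{Suc D..G}. ?S g)" using k g by auto
  qed
  hence "card {k \<in> {1..<int n}. gcd \<lfloor>of_int k * \<alpha>\<rfloor> k > int D} \<le> card (\<Union>g\<in>{Suc D..G}. ?S g)"
    by (intro card_mono) auto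
  also have "\<dots> \<le> (\<Sum>g=Suc D..G. card (?S g))"
    by (rule card_UN_le) simp
  finally have "real (card {k \<in> {1..<int n}. gcd \<lfloor>of_int k * \<alpha>\<rfloor> k > int D}) \<le> (\<Sum>g=Suc D..G. real (card (?S g)))"
    by (simp only: of_nat_sum[symmetric] of_nat_le_iff)
  also have "\<dots> \<le> (\<Sum>g=Suc D..G. 2 * real n * (1 / real g ^ 2) + 2)"
  proof (rule sum_mono)
    fix g assume "g \<in> {Suc D..G}"
    thus "real (card (?S g)) \<le> 2 * real n * (1 / real g ^ 2) + 2"
      using card_gcd_floor_eq_le[OF assms(1), of "int g" n] elim(2) by simp
  qed
  also have "\<dots> = 2 * real n * (\<Sum>g=Suc D..G. 1 / real g ^ 2) + 2 * real (G - D)"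
    by (simp add: sum.distrib sum_distrib_left)
  also have "\<dots> \<le> 2 * real n * (1 / real D) + 2 * (\<epsilon> * real n)"
    using sum_inverse_squares_tail_le[OF assms(3), of G] G
    by (intro add_mono mult_left_mono) auto
  finally show ?case using elim(2) by (simp add: field_simps)
qed

section \<open>The Euler product\<close>

text \<open>The Euler product of zeta(2), one prime at a time: among the integers already sifted by
  \<open>P\<close>, the multiples of a new prime \<open>p\<close> contribute \<open>1 / p^2\<close>
  times the whole sum, because \<open>n = p * m\<close> survives exactly when \<open>m\<close> does.
  The induction starts from the Basel series.\<close>

lemma sums_sifted_inverse_squares:
  assumes "finite P" and "\<And>p. p \<in> P \<Longrightarrow> prime p"
  shows "(\<lambda>n. if n > 0 \<and> (\<forall>p\<in>P. \<not> p dvd n) then 1 / real n ^ 2 else 0) sums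
    (pi ^ 2 / 6 * (\<Prod>p\<in>P. 1 - 1 / real p ^ 2))"
  using assms
proof (induction P rule: finite_induct)
  case empty
  let ?f = "\<lambda>n. if n > 0 \<and> (\<forall>p\<in>{}. \<not> p dvd n) then 1 / real n ^ 2 else 0"
  have "(\<lambda>n. ?f (Suc n)) sums (pi ^ 2 / 6)"
    using inverse_squares_sums by (simp add: add.commute)
  thus ?case using sums_Suc_iff[of ?f "pi ^ 2 / 6"] by simp
next
  case (insert p P)
  let ?f = "\<lambda>P n. if n > 0 \<and> (\<forall>p\<in>P. \<not> p dvd n) then 1 / real n ^ 2 else 0"
  let ?s = "pi ^ 2 / 6 * (\<Prod>p\<in>P. 1 - 1 / real p ^ 2)"
  define h where "h n = (if p dvd n then ?f P n else 0)" for n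
  have p: "prime p" using insert.prems by simp
  have f: "?f P sums ?s" using insert by simp
  have iff: "q dvd p * m \<longleftrightarrow> q dvd m" if "q \<in> P" for q m
  proof -
    have "coprime q p" using that insert p by (intro primes_coprime) auto
    thus ?thesis by (simp add: coprime_dvd_mult_right_iff)
  qed
  have "(\<lambda>m. h (p * m)) = (\<lambda>m. ?f P m * (1 / real p ^ 2))"
    using p iff by (auto simp: h_def power_mult_distrib prime_gt_0_nat fun_eq_iff)
  hence "(\<lambda>m. h (p * m)) sums (?s * (1 / real p ^ 2))"
    using sums_mult2[OF f] by (simp only:)
  moreover have "strict_mono (\<lambda>m. p * m)" using prime_gt_0_nat[OF p] by (simp add: strict_mono_def)
  moreover have "h n = 0" if "n \<notin> range (\<lambda>m. p * m)" for n
    using that by (auto simp: h_def)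
  ultimately have "h sums (?s * (1 / real p ^ 2))"
    using sums_mono_reindex[of "\<lambda>m. p * m" h] by simp
  from sums_diff[OF f this] have "(\<lambda>n. ?f P n - h n) sums (?s - ?s * (1 / real p ^ 2))" .
  moreover have "(\<lambda>n. ?f P n - h n) = ?f (insert p P)"
    by (auto simp: h_def fun_eq_iff)
  moreover have "?s - ?s * (1 / real p ^ 2) = pi ^ 2 / 6 * (\<Prod>p\<in>insert p P. 1 - 1 / real p ^ 2)"
    using insert.hyps by (simp add: algebra_simps)
  ultimately show ?case by (simp only:)
qed

definition partial_kappa :: "nat \<Rightarrow> real" where
  "partial_kappa D = (\<Prod>p\<in>{p. prime p \<and> p \<le> D}. 1 - 1 / real p ^ 2)"

lemma partial_kappa_tendsto: "partial_kappa \<longlonglongrightarrow> kappa"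
proof -
  have "(\<Prod>p\<le>D. if prime p then 1 - 1 / real p ^ 2 else 1) = partial_kappa D" for D
    unfolding partial_kappa_def by (rule prod.mono_neutral_cong_right) auto
  thus ?thesis
    using convergent_prod_LIMSEQ[OF convergent_prod_kappa] by (simp add: kappa_def)
qed

text \<open>The product equals the sum of \<open>1 / n^2\<close> over the positive \<open>n\<close>
  free of primes up to \<open>D\<close>. Such an \<open>n\<close> is 1 or exceeds \<open>D\<close>,
  so the sum is 1 plus at most the tail beyond \<open>D\<close>.\<close>

lemma partial_kappa_bounds:
  assumes "D > 0"
  shows "1 \<le> pi ^ 2 / 6 * partial_kappa D" "pi ^ 2 / 6 * partial_kappa D \<le> 1 + 1 / real D"
proof -
  define f where "f n = (if n > 0 \<and> (\<forall>p\<in>{p. prime p \<and> p \<le> D}. \<not> p dvd n) then 1 / real n ^ 2 else 0)" for n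
  have f: "f sums (pi ^ 2 / 6 * partial_kappa D)"
    unfolding f_def partial_kappa_def by (rule sums_sifted_inverse_squares) auto
  have nonneg: "f n \<ge> 0" for n by (simp add: f_def)
  have "f 1 = 1" by (auto simp: f_def)
  moreover have "sum f {1} \<le> suminf f"
    using sums_summable[OF f] nonneg by (intro sum_le_suminf) auto
  ultimately show "1 \<le> pi ^ 2 / 6 * partial_kappa D"
    using sums_unique[OF f] by simp
  have zero: "f n = 0" if "n \<notin> insert 1 {Suc D..}" for n
  proof (cases "n = 0")
    case False
    with that have "n \<noteq> 1" "n \<le> D" by auto
    then obtain p where "prime p" "p dvd n" using prime_factor_nat by blast
    moreover have "p \<le> n" using \<open>p dvd n\<close> False by (intro dvd_imp_le) auto
    ultimately show ?thesis using \<open>n \<le> D\<close> by (auto simp: f_def)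
  qed (simp add: f_def)
  have "sum f {..<G} \<le> 1 + 1 / real D" for G
  proof -
    have "sum f {..<G} = sum f ({..<G} \<inter> insert 1 {Suc D..G})"
      using zero by (intro sum.mono_neutral_right) auto
    also have "\<dots> \<le> sum f (insert 1 {Suc D..G})"
      using nonneg by (intro sum_mono2) auto
    also have "\<dots> = f 1 + sum f {Suc D..G}"
      using assms by (subst sum.insert) auto
    also have "\<dots> \<le> 1 + (\<Sum>g=Suc D..G. 1 / real g ^ 2)"
      by (intro add_mono sum_mono) (auto simp: f_def)
    also have "\<dots> \<le> 1 + 1 / real D"
      using sum_inverse_squares_tail_le[OF assms] by simp
    finally show ?thesis .
  qed
  thus "pi ^ 2 / 6 * partial_kappa D \<le> 1 + 1 / real D"
    using f unfolding sums_def by (intro LIMSEQ_le_const2) auto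
qed

lemma kappa_eq: "kappa = 6 / pi ^ 2"
proof -
  have "(\<lambda>D. pi ^ 2 / 6 * partial_kappa D) \<longlonglongrightarrow> pi ^ 2 / 6 * kappa"
    by (intro tendsto_intros partial_kappa_tendsto)
  moreover have "(\<lambda>D. pi ^ 2 / 6 * partial_kappa D) \<longlonglongrightarrow> 1"
  proof (rule tendsto_sandwich[where f = "\<lambda>_. 1" and h = "\<lambda>D. 1 + 1 / real D"])
    have "(\<lambda>D. 1 + 1 / real D) \<longlonglongrightarrow> 1 + 0"
      by (intro tendsto_intros lim_1_over_n)
    thus "(\<lambda>D. 1 + 1 / real D) \<longlonglongrightarrow> 1" by simp
  qed (auto intro: eventually_mono[OF eventually_gt_at_top[of 0]] partial_kappa_bounds
      simp del: times_divide_eq_left)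
  ultimately have "pi ^ 2 / 6 * kappa = 1" by (rule LIMSEQ_unique)
  thus ?thesis by (simp add: field_simps)
qed

section \<open>Density of the coprime pairs\<close>

text \<open>First \<open>D\<close> is fixed, then \<open>n\<close> grows. The error has four parts
  of at most \<open>\<epsilon> / 4\<close>: replacing \<open>kappa\<close> by
  \<open>partial_kappa D\<close>, the sieve at fixed \<open>D\<close>, and the terms
  \<open>2 / D\<close> and \<open>2 * (\<epsilon> / 8)\<close> for large gcds.\<close>

lemma has_density_coprime_floor:
  fixes \<alpha> a b :: real
  assumes "\<alpha> \<notin> \<rat>" and "0 \<le> a" "a \<le> b" "b \<le> 1" and "{a<..<b} \<subseteq> I" "I \<subseteq> {a..b}" "I \<subseteq> {0..<1}"
  shows "has_density (\<lambda>k. gcd \<lfloor>of_int k * \<alpha>\<rfloor> k = 1 \<and> frac (of_int k * \<alpha>) \<in> I) (kappa * (b - a))"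
  unfolding has_density_def
proof (rule tendstoI)
  fix \<epsilon> :: real assume "\<epsilon> > 0"
  let ?g = "\<lambda>k. gcd \<lfloor>of_int k * \<alpha>\<rfloor> k"
  have "(\<lambda>D. (b - a) * partial_kappa D) \<longlonglongrightarrow> (b - a) * kappa"
    by (intro tendsto_intros partial_kappa_tendsto)
  hence "\<forall>\<^sub>F D in sequentially. \<bar>(b - a) * partial_kappa D - (b - a) * kappa\<bar> < \<epsilon> / 4"
    using tendstoD[of _ "(b - a) * kappa" _ "\<epsilon> / 4"] \<open>\<epsilon> > 0\<close> by (simp add: dist_real_def)
  moreover have "\<forall>\<^sub>F D in sequentially. 2 / real D < \<epsilon> / 4"
    using \<open>\<epsilon> > 0\<close> by (intro order_tendstoD[OF lim_const_over_n]) auto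
  ultimately have "\<forall>\<^sub>F D in sequentially. \<bar>(b - a) * partial_kappa D - (b - a) * kappa\<bar> < \<epsilon> / 4 \<and>
      2 / real D < \<epsilon> / 4 \<and> D > 0"
    using eventually_gt_at_top[of 0] by eventually_elim auto
  then obtain D where D: "\<bar>(b - a) * partial_kappa D - (b - a) * kappa\<bar> < \<epsilon> / 4"
      "2 / real D < \<epsilon> / 4" "D > 0"
    using eventually_happens'[OF sequentially_bot] by blast
  let ?P = "{p. prime p \<and> p \<le> D}"
  \<comment> \<open>The sieve with trivial modulus \<open>d = 1\<close>. Its survivors
    \<open>?S\<close> contain \<open>?T\<close>, and lie in \<open>?T \<union> ?L\<close> because a
    gcd without prime factor up to \<open>D\<close> is 1 or exceeds \<open>D\<close>.\<close>
  let ?S = "\<lambda>n. {k \<in> {1..<int n}. (frac (of_int k * \<alpha>) \<in> I \<and> int 1 dvd ?g k) \<and> (\<forall>p\<in>?P. \<not> int p dvd ?g k)}"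
  let ?T = "\<lambda>n. {k \<in> {1..<int n}. ?g k = 1 \<and> frac (of_int k * \<alpha>) \<in> I}"
  let ?L = "\<lambda>n. {k \<in> {1..<int n}. ?g k > int D}"
  have "(\<lambda>n. real (card (?S n)) / real n) \<longlonglongrightarrow> (b - a) / real 1 ^ 2 * partial_kappa D"
    unfolding partial_kappa_def has_density_def[symmetric] by (rule has_density_sieve[OF assms]) auto
  hence "\<forall>\<^sub>F n in sequentially. \<bar>real (card (?S n)) / real n - (b - a) * partial_kappa D\<bar> < \<epsilon> / 4"
    using tendstoD[of _ "(b - a) / real 1 ^ 2 * partial_kappa D" sequentially "\<epsilon> / 4"] \<open>\<epsilon> > 0\<close>
    by (simp add: dist_real_def)
  moreover have "\<forall>\<^sub>F n in sequentially. real (card (?L n)) / real n \<le> 2 / real D + 2 * (\<epsilon> / 8)"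
    using \<open>\<epsilon> > 0\<close> D by (intro eventually_card_large_gcd_le assms) auto
  ultimately show "\<forall>\<^sub>F n in sequentially. dist (real (card (?T n)) / real n) (kappa * (b - a)) < \<epsilon>"
  proof eventually_elim
    case (elim n)
    have sub: "?T n \<subseteq> ?S n"
    proof
      fix k assume k: "k \<in> ?T n"
      hence g: "?g k = 1" by simp
      have "\<not> int p dvd ?g k" if "p \<in> ?P" for p
        using prime_gt_1_nat[of p] that unfolding g by auto
      thus "k \<in> ?S n" using k by simp
    qed
    have "card (?T n) \<le> card (?S n)" by (intro card_mono[OF _ sub]) simp
    hence "real (card (?T n)) / real n \<le> real (card (?S n)) / real n"
      by (intro divide_right_mono) auto
    moreover have "?S n \<subseteq> ?T n \<union> ?L n"
    proof
      fix k assume k: "k \<in> ?S n"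
      define g where "g = nat (?g k)"
      have g: "?g k = int g" by (simp add: g_def)
      have "g > 0" using k by (simp add: g_def)
      have "g = 1 \<or> g > D"
      proof (rule ccontr)
        assume *: "\<not> (g = 1 \<or> g > D)"
        then obtain p where p: "prime p" "p dvd g" using prime_factor_nat by blast
        have "p \<le> D" using * dvd_imp_le[OF p(2) \<open>g > 0\<close>] by simp
        moreover have "int p dvd ?g k" using p(2) unfolding g by simp
        moreover have "\<forall>p\<in>?P. \<not> int p dvd ?g k" using k by blast
        ultimately show False using p(1) by blast
      qed
      thus "k \<in> ?T n \<union> ?L n" using k g by auto
    qed
    hence "card (?S n) \<le> card (?T n \<union> ?L n)" by (intro card_mono) auto
    hence "card (?S n) \<le> card (?T n) + card (?L n)" using card_Un_le order_trans by blast
    hence "real (card (?S n)) / real n \<le> (real (card (?T n)) + real (card (?L n))) / real n"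
      by (intro divide_right_mono) linarith+
    hence "real (card (?S n)) / real n \<le> real (card (?T n)) / real n + real (card (?L n)) / real n"
      by (simp only: add_divide_distrib)
    ultimately show ?case
      using elim D unfolding dist_real_def mult.commute[of kappa] by linarith
  qed
qed

section \<open>Endpoints and length of a real interval\<close>

lemma real_interval_endpoints:
  fixes I :: "real set"
  assumes "is_interval I" and "I \<subseteq> {0..<1}"
  obtains a b where "0 \<le> a" "a \<le> b" "b \<le> 1" "{a<..<b} \<subseteq> I" "I \<subseteq> {a..b}"
proof (cases "I = {}")
  case True
  thus ?thesis using that[of 0 0] by simp
next
  case False
  have bdd: "bdd_below I" "bdd_above I"
    using assms(2) by (auto intro!: bdd_belowI[of _ 0] bdd_aboveI[of _ 1])
  show ?thesis
  proof (rule that)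
    show "0 \<le> Inf I" using False assms(2) by (intro cInf_greatest) auto
    show "Sup I \<le> 1" using False assms(2) by (intro cSup_least) auto
    show "Inf I \<le> Sup I" using False bdd by (intro cInf_le_cSup)
    show "I \<subseteq> {Inf I..Sup I}" using bdd by (auto intro: cInf_lower cSup_upper)
    show "{Inf I<..<Sup I} \<subseteq> I"
    proof
      fix x assume "x \<in> {Inf I<..<Sup I}"
      then obtain u v where "u \<in> I" "u < x" "v \<in> I" "x < v"
        using cInf_lessD[OF False] less_cSupE[OF _ False] by (metis greaterThanLessThan_iff)
      thus "x \<in> I" using mem_is_interval_1_I[OF assms(1), of u v x] by simp
    qed
  qed
qed

lemma measure_real_interval:
  fixes a b :: real
  assumes "a \<le> b" and "{a<..<b} \<subseteq> I" and "I \<subseteq> {a..b}"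
  shows "measure lebesgue I = b - a"
proof -
  \<comment> \<open>Up to at most two points \<open>I\<close> is an open interval, which gives the
    measurability that monotonicity of the measure requires.\<close>
  have "I = {a<..<b} \<union> (I \<inter> {a, b})" using assms by auto
  moreover have "finite (I \<inter> {a, b})" by simp
  hence "I \<inter> {a, b} \<in> sets lebesgue" by (intro negligible_imp_sets negligible_finite)
  ultimately have "I \<in> sets lebesgue" by (metis lmeasurable_box box_real(1) fmeasurableD sets.Un)
  moreover have "{a..b} \<in> lmeasurable" by simp
  ultimately have I: "I \<in> lmeasurable"
    using assms(3) fmeasurableI2 by blast
  have "measure lebesgue {a<..<b} \<le> measure lebesgue I"
    using assms I by (intro measure_mono_fmeasurable) auto
  moreover have "measure lebesgue I \<le> measure lebesgue {a..b}"
    using assms I by (intro measure_mono_fmeasurable) (auto dest: fmeasurableD)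
  ultimately show ?thesis using assms(1) by simp
qed

theorem theorem2p1:
  fixes \<alpha> :: real
  assumes "0 < \<alpha>" and "\<alpha> < 1" and "\<alpha> \<notin> \<rat>"
  shows "kappa = 6 / pi ^ 2 \<and>
    (\<exists>N :: nat \<Rightarrow> nat. strict_mono N \<and> (\<forall>k. N k \<ge> 1) \<and>
      (\<forall>I :: real set. is_interval I \<and> I \<subseteq> {0..<1} \<longrightarrow>
        (\<exists>e :: nat \<Rightarrow> real. e \<longlonglongrightarrow> 0 \<and>
          (\<forall>k. real (card (J_hat \<alpha> (N k) I)) =
               (kappa * measure lebesgue I + e k) * real_of_int (cf_denom \<alpha> (N k + 1))))))"
\<comment> \<open>The density exists along all \<open>n\<close>, so every positive index may be
  taken, chosen before \<open>I\<close>; \<open>Suc\<close> rather than the identity because the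
  indices start at 1.\<close>
proof (intro conjI exI[of _ Suc] allI impI)
  show "kappa = 6 / pi ^ 2" by (rule kappa_eq)
  show "strict_mono Suc" by (simp add: strict_mono_Suc_iff)
  show "Suc k \<ge> 1" for k by simp
next
  fix I :: "real set" assume I: "is_interval I \<and> I \<subseteq> {0..<1}"
  then obtain a b where ab: "0 \<le> a" "a \<le> b" "b \<le> 1" "{a<..<b} \<subseteq> I" "I \<subseteq> {a..b}"
    using real_interval_endpoints by blast
  \<comment> \<open>The denominator of index \<open>N k + 1 = k + 2\<close>, whence the shift by 2
    in its limit.\<close>
  define Q where "Q k = nat (cf_denom \<alpha> (Suc k + 1))" for k
  have Q: "Q k > 0" "cf_denom \<alpha> (Suc k + 1) = int (Q k)" for k
    by (simp_all add: Q_def cf_denom_def quotient_of_denom_pos' order.strict_implies_order)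
  \<comment> \<open>The required identity solved for the error term, which is possible as
    \<open>Q k > 0\<close>.\<close>
  define e where "e k = real (card (J_hat \<alpha> (Suc k) I)) / real (Q k) - kappa * measure lebesgue I" for k
  have "filterlim Q sequentially sequentially"
    unfolding Q_def using filterlim_compose[OF cf_denom_at_top[OF assms] filterlim_add_const_nat_at_top[of 2]]
    by simp
  hence "(\<lambda>k. real (card {j \<in> {1..<int (Q k)}. gcd \<lfloor>of_int j * \<alpha>\<rfloor> j = 1 \<and> frac (of_int j * \<alpha>) \<in> I}) / real (Q k))
      \<longlonglongrightarrow> kappa * (b - a)"
    using has_density_coprime_floor[OF assms(3) ab] I unfolding has_density_def
    by (auto intro: filterlim_compose)
  moreover have "{j \<in> {1..<int (Q k)}. gcd \<lfloor>of_int j * \<alpha>\<rfloor> j = 1 \<and> frac (of_int j * \<alpha>) \<in> I} =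
      J_hat \<alpha> (Suc k) I" for k
    unfolding J_hat_def J_def Q(2) by auto
  ultimately have "e \<longlonglongrightarrow> 0"
    unfolding e_def measure_real_interval[OF ab(2,4,5)] by (simp add: LIM_zero)
  moreover have "real (card (J_hat \<alpha> (Suc k) I)) =
      (kappa * measure lebesgue I + e k) * real_of_int (cf_denom \<alpha> (Suc k + 1))" for k
    using Q(1)[of k] unfolding Q(2) by (simp add: e_def)
  ultimately show "\<exists>e. e \<longlonglongrightarrow> 0 \<and> (\<forall>k. real (card (J_hat \<alpha> (Suc k) I)) =
      (kappa * measure lebesgue I + e k) * real_of_int (cf_denom \<alpha> (Suc k + 1)))" by blast
qed

end
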